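(* Let $M$ be a smooth manifold and let $R_d\colon U\subset TM\to M\times M$ be a discretization map on $M$. Let $I_M\colon M\times M\to M\times M$ be the inversion map $I_M(x,y)=(y,x)$, and let $\overline{U}=\{(x,v)\in TM \mid (x,-v)\in U\}$. Then the map $R_d^*\colon\overline{U}\subset TM\to M\times M$ defined by $$R_d^*(x,v)=(I_M\circ R_d)(x,-v)$$ is also a discretization map on $M$.
   Context: Discretization map: let $M$ be a smooth manifold and $U\subset TM$ an open neighborhood of the zero section. A smooth map $R_d\colon U\to M\times M$, $R_d(x,v)=(R^1(x,v),R^2(x,v))$, is a discretization map on $M$ if (1) $R_d(x,0)=(x,x)$ for all $x\in M$; and (2) for every $x\in M$, $T_{0_x}R^2_x-T_{0_x}R^1_x\colon T_{0_x}T_xM\simeq T_xM\to T_xM$ is the identity map of $T_xM$, where $R^a_x$ is the restriction of $R^a$ to (the part in $U$ of) $T_xM$, $a=1,2$, and $0_x$ is the zero vector of $T_xM$. The map $R_d^*$ is called the adjoint discretization map of $R_d$. *)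

theory Defs
  imports "HOL-Analysis.Analysis" "HOL-Library.Function_Algebras"
begin

subsection \<open>Smooth maps between normed spaces\<close>

text \<open>The notion is meant for open \<open>S\<close> and finite-dimensional domain; there it is the usual
  \<open>C\<^sup>\<infinity>\<close> notion, with \<open>C\<^sup>k\<^sup>+\<^sup>1\<close> meaning that all directional derivatives of the differentiable
  map \<open>f\<close> are \<open>C\<^sup>k\<close>.\<close>

primrec Ck_on ::
  "nat \<Rightarrow> 'a::real_normed_vector set \<Rightarrow> ('a \<Rightarrow> 'b::real_normed_vector) \<Rightarrow> bool"
where
  "Ck_on 0 S f \<longleftrightarrow> continuous_on S f"
| "Ck_on (Suc k) S f \<longleftrightarrow>
     (\<forall>x\<in>S. f differentiable (at x)) \<and>
     (\<forall>v. Ck_on k S (\<lambda>x. frechet_derivative f (at x) v))"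

definition smooth_on ::
  "'a::real_normed_vector set \<Rightarrow> ('a \<Rightarrow> 'b::real_normed_vector) \<Rightarrow> bool"
  where "smooth_on S f \<longleftrightarrow> (\<forall>k. Ck_on k S f)"


subsection \<open>Smooth manifolds\<close>

text \<open>A chart \<open>(D, \<phi>)\<close> consists of its domain and a coordinate map; the values of \<open>\<phi>\<close> outside
  \<open>D\<close> are irrelevant.\<close>

type_synonym ('a, 'e) chart = "'a set \<times> ('a \<Rightarrow> 'e)"

record ('a, 'e) mfd =
  mtop :: "'a topology"
  atlas :: "('a, 'e) chart set"

abbreviation points :: "('a, 'e) mfd \<Rightarrow> 'a set"
  where "points M \<equiv> topspace (mtop M)"

definition chart_inv :: "('a, 'e) chart \<Rightarrow> 'e \<Rightarrow> 'a"
  where "chart_inv c = inv_into (fst c) (snd c)"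

definition charts_at :: "('a, 'e) mfd \<Rightarrow> 'a \<Rightarrow> ('a, 'e) chart set"
  where "charts_at M p = {c \<in> atlas M. p \<in> fst c}"

text \<open>The model space is any finite-dimensional real normed space. Class \<open>euclidean_space\<close>
  would exclude manifolds of dimension 0.\<close>

definition smooth_manifold :: "('a, 'e::real_normed_vector) mfd \<Rightarrow> bool"
  where "smooth_manifold M \<longleftrightarrow>
    (\<exists>B::'e set. finite B \<and> span B = UNIV) \<and>
    Hausdorff_space (mtop M) \<and>
    second_countable (mtop M) \<and>
    \<Union> (fst ` atlas M) = points M \<and>
    (\<forall>c\<in>atlas M.
       openin (mtop M) (fst c) \<and>
       open (snd c ` fst c) \<and>
       homeomorphic_map (subtopology (mtop M) (fst c)) (top_of_set (snd c ` fst c)) (snd c)) \<and>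
    (\<forall>c\<in>atlas M. \<forall>d\<in>atlas M.
       smooth_on (snd c ` (fst c \<inter> fst d)) (snd d \<circ> chart_inv c))"

definition prod_mfd :: "('a, 'e) mfd \<Rightarrow> ('b, 'f) mfd \<Rightarrow> ('a \<times> 'b, 'e \<times> 'f) mfd"
  where "prod_mfd M N =
    \<lparr> mtop = prod_topology (mtop M) (mtop N),
      atlas = {(fst c \<times> fst d, map_prod (snd c) (snd d)) | c d. c \<in> atlas M \<and> d \<in> atlas N} \<rparr>"

text \<open>Smoothness of a map \<open>f\<close> defined on an open subset \<open>W\<close> of \<open>M\<close>, with values in \<open>N\<close>.\<close>

definition smooth_map_on ::
  "('a, 'e::real_normed_vector) mfd \<Rightarrow> ('b, 'f::real_normed_vector) mfd \<Rightarrow> 'a set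
     \<Rightarrow> ('a \<Rightarrow> 'b) \<Rightarrow> bool"
  where "smooth_map_on M N W f \<longleftrightarrow>
    openin (mtop M) W \<and>
    continuous_map (subtopology (mtop M) W) (mtop N) f \<and>
    (\<forall>c\<in>atlas M. \<forall>d\<in>atlas N.
       smooth_on (snd c ` {p \<in> fst c \<inter> W. f p \<in> fst d}) (snd d \<circ> f \<circ> chart_inv c))"


subsection \<open>Tangent spaces and the tangent bundle\<close>

text \<open>A tangent vector \<open>v\<close> at \<open>p\<close> is the family \<open>(v c)\<close> of its coordinate vectors in all charts
  \<open>c\<close> around \<open>p\<close>, which are related by the derivatives of the transition maps. It is \<open>0\<close> on
  charts not around \<open>p\<close>, so that equality of tangent vectors is equality of functions and the
  pointwise operations on functions (zero, minus) are the vector space operations.\<close>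

type_synonym ('a, 'e) tvec = "('a, 'e) chart \<Rightarrow> 'e"

definition tangent_space :: "('a, 'e::real_normed_vector) mfd \<Rightarrow> 'a \<Rightarrow> ('a, 'e) tvec set"
  where "tangent_space M p =
    {v. (\<forall>c. c \<notin> charts_at M p \<longrightarrow> v c = 0) \<and>
        (\<forall>c\<in>charts_at M p. \<forall>d\<in>charts_at M p.
           v d = frechet_derivative (snd d \<circ> chart_inv c) (at (snd c p)) (v c))}"

text \<open>The tangent map \<open>T\<^sub>pf\<close> of a map \<open>f\<close> that is defined and smooth near \<open>p\<close>, computed in an
  arbitrary chart around \<open>p\<close>.\<close>

definition tangent_map ::
  "('a, 'e::real_normed_vector) mfd \<Rightarrow> ('b, 'f::real_normed_vector) mfd \<Rightarrow> ('a \<Rightarrow> 'b) \<Rightarrow> 'a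
     \<Rightarrow> ('a, 'e) tvec \<Rightarrow> ('b, 'f) tvec"
  where "tangent_map M N f p w =
    (let c = (SOME c. c \<in> charts_at M p) in
       (\<lambda>d. if d \<in> charts_at N (f p)
            then frechet_derivative (snd d \<circ> f \<circ> chart_inv c) (at (snd c p)) (w c)
            else 0))"

definition TM_points :: "('a, 'e::real_normed_vector) mfd \<Rightarrow> ('a \<times> ('a, 'e) tvec) set"
  where "TM_points M = Sigma (points M) (tangent_space M)"

definition TM_chart ::
  "('a, 'e::real_normed_vector) mfd \<Rightarrow> ('a, 'e) chart \<Rightarrow> ('a \<times> ('a, 'e) tvec, 'e \<times> 'e) chart"
  where "TM_chart M c = (Sigma (fst c) (tangent_space M), \<lambda>(x, v). (snd c x, v c))"

definition tangent_bundle ::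
  "('a, 'e::real_normed_vector) mfd \<Rightarrow> ('a \<times> ('a, 'e) tvec, 'e \<times> 'e) mfd"
  where "tangent_bundle M =
    \<lparr> mtop = topology_generated_by
        {{z \<in> fst (TM_chart M c). snd (TM_chart M c) z \<in> V} | c V. c \<in> atlas M \<and> open V},
      atlas = TM_chart M ` atlas M \<rparr>"

text \<open>The vector space \<open>T\<^sub>xM\<close> as a manifold: its charts are the linear coordinate maps
  \<open>v \<mapsto> v c\<close> for charts \<open>c\<close> of \<open>M\<close> around \<open>x\<close>.\<close>

definition tangent_space_mfd ::
  "('a, 'e::real_normed_vector) mfd \<Rightarrow> 'a \<Rightarrow> (('a, 'e) tvec, 'e) mfd"
  where "tangent_space_mfd M x =
    \<lparr> mtop = topology_generated_by
        {{v \<in> tangent_space M x. v c \<in> V} | c V. c \<in> charts_at M x \<and> open V},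
      atlas = {(tangent_space M x, \<lambda>v. v c) | c. c \<in> charts_at M x} \<rparr>"

text \<open>The canonical identification \<open>T\<^sub>xM \<simeq> T\<^sub>0(T\<^sub>xM)\<close> sends \<open>w\<close> to the velocity at \<open>t = 0\<close> of the
  curve \<open>t \<mapsto> t w\<close>; its coordinate in a linear chart \<open>\<lambda>\<close> of \<open>T\<^sub>xM\<close> is \<open>\<lambda>(w)\<close>.\<close>

definition vertical_lift ::
  "('a, 'e::real_normed_vector) mfd \<Rightarrow> 'a \<Rightarrow> ('a, 'e) tvec \<Rightarrow> (('a, 'e) tvec, 'e) tvec"
  where "vertical_lift M x w =
    (\<lambda>l. if l \<in> charts_at (tangent_space_mfd M x) 0 then snd l w else 0)"


subsection \<open>Discretization maps\<close>

definition discretization_map ::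
  "('a, 'e::real_normed_vector) mfd \<Rightarrow> ('a \<times> ('a, 'e) tvec) set
     \<Rightarrow> ('a \<times> ('a, 'e) tvec \<Rightarrow> 'a \<times> 'a) \<Rightarrow> bool"
  where "discretization_map M U R \<longleftrightarrow>
    openin (mtop (tangent_bundle M)) U \<and>
    (\<forall>x\<in>points M. (x, 0) \<in> U) \<and>
    smooth_map_on (tangent_bundle M) (prod_mfd M M) U R \<and>
    (\<forall>x\<in>points M. R (x, 0) = (x, x)) \<and>
    (\<forall>x\<in>points M. \<forall>w\<in>tangent_space M x.
       tangent_map (tangent_space_mfd M x) M (\<lambda>v. snd (R (x, v))) 0 (vertical_lift M x w)
       - tangent_map (tangent_space_mfd M x) M (\<lambda>v. fst (R (x, v))) 0 (vertical_lift M x w)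
       = w)"

definition inversion_map :: "'a \<times> 'a \<Rightarrow> 'a \<times> 'a"
  where "inversion_map = (\<lambda>(x, y). (y, x))"

definition adjoint_domain ::
  "('a, 'e::real_normed_vector) mfd \<Rightarrow> ('a \<times> ('a, 'e) tvec) set \<Rightarrow> ('a \<times> ('a, 'e) tvec) set"
  where "adjoint_domain M U = {(x, v). (x, v) \<in> TM_points M \<and> (x, - v) \<in> U}"

definition adjoint_map ::
  "('a \<times> ('a, 'e::real_normed_vector) tvec \<Rightarrow> 'a \<times> 'a) \<Rightarrow> ('a \<times> ('a, 'e) tvec \<Rightarrow> 'a \<times> 'a)"
  where "adjoint_map R = (\<lambda>(x, v). (inversion_map \<circ> R) (x, - v))"

end

theory Submission
  imports Defs
begin

text \<open>
  The adjoint is \<open>R\<^sub>d\<close> preceded by the fibrewise reflection \<open>(x, v) \<mapsto> (x, - v)\<close> of the tangent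
  bundle and followed by the swap of the two factors. In every chart both of these are restrictions
  of bounded linear maps, so smoothness survives. The reflection negates the derivative of each
  component at \<open>0\<^sub>x\<close> and the swap exchanges the two components, so the difference of the two
  derivatives is unchanged.
\<close>

subsection \<open>Joint continuity of families of linear maps\<close>

text \<open>Iterated derivatives can be transported along a linear change of coordinates only over
  open sets. The sets on which \<open>smooth_map_on\<close> tests a map come from open sets of the
  tangent bundle through its charts, and their openness is the main obstacle: the bundle topology
  has only a subbasis, whose members are described in charts other than the one in use. The
  transition maps \<open>(y, u)\<close> -> (tau(y), D tau(y) u) must therefore be jointly
  continuous, whereas \<open>Ck_on\<close> gives continuity of D tau(y) u in y for each fixed u.
  Linearity in u closes the gap, provided that basis coordinates are continuous on an arbitrary
  finite-dimensional normed space; this is the purpose of the opening estimate. The linear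
  composites P o f o L are convenient because differentiating in a fixed direction v gives the same
  form again, with f replaced by its derivative in direction L v.\<close>

lemma independent_coeff_bound:
  fixes B :: "'e::real_normed_vector set"
  assumes "finite B" "independent B"
  obtains C where "\<And>a. (\<Sum>b\<in>B. \<bar>a b\<bar>) \<le> C * norm (\<Sum>b\<in>B. a b *\<^sub>R b)"
proof -
  \<comment> \<open>On the compact unit sphere of the l1 norm the combination never vanishes, by
    independence, so its norm has a positive lower bound. The general estimate follows by
    scaling.\<close>
  have "\<exists>\<delta>>0. \<forall>a. (\<Sum>b\<in>B. \<bar>a b\<bar>) = 1 \<longrightarrow> \<delta> \<le> norm (\<Sum>b\<in>B. a b *\<^sub>R b)"
  proof (rule ccontr)
    assume neg: "\<not> ?thesis"
    have "\<exists>a. (\<Sum>b\<in>B. \<bar>a b\<bar>) = 1 \<and> norm (\<Sum>b\<in>B. a b *\<^sub>R b) < inverse (real (Suc n))" for n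
      using neg by (metis inverse_positive_iff_positive not_le of_nat_0_less_iff zero_less_Suc)
    then obtain f :: "nat \<Rightarrow> 'e \<Rightarrow> real" where f1: "\<And>n. (\<Sum>b\<in>B. \<bar>f n b\<bar>) = 1"
      and f2: "\<And>n. norm (\<Sum>b\<in>B. f n b *\<^sub>R b) < inverse (real (Suc n))"
      by metis
    have "\<bar>f n b\<bar> \<le> 1" if "b \<in> B" for n b
      using member_le_sum[of b B "\<lambda>b. \<bar>f n b\<bar>"] that assms(1) f1[of n] by simp
    then have "bounded (range (\<lambda>n. f n b))" if "b \<in> B" for b
      using that by (auto simp: bounded_iff)
    \<comment> \<open>One subsequence serves all coordinates at once, since \<open>B\<close> is
      finite and each coordinate stays in [-1, 1].\<close>
    then have "\<exists>l r. strict_mono (r::nat \<Rightarrow> nat) \<and>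
        (\<forall>\<epsilon>>0. eventually (\<lambda>n. \<forall>b\<in>B. dist (f (r n) b) (l b) < \<epsilon>) sequentially)"
      using compact_lemma_general[of B "\<lambda>a b. a b" f "\<lambda>a. a"] assms(1)
      by (force simp: image_image)
    then obtain l r where r: "strict_mono (r::nat \<Rightarrow> nat)"
      and l: "\<And>\<epsilon>. \<epsilon> > 0 \<Longrightarrow> eventually (\<lambda>n. \<forall>b\<in>B. dist (f (r n) b) (l b) < \<epsilon>) sequentially"
      by blast
    have lim: "(\<lambda>n. f (r n) b) \<longlonglongrightarrow> l b" if "b \<in> B" for b
      unfolding tendsto_iff
    proof (intro allI impI)
      fix e :: real
      assume "0 < e"
      from l[OF this] show "\<forall>\<^sub>F n in sequentially. dist (f (r n) b) (l b) < e"
        by (rule eventually_mono) (use that in blast)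
    qed
    have "(\<lambda>n. \<Sum>b\<in>B. f n b *\<^sub>R b) \<longlonglongrightarrow> 0"
      by (rule Lim_null_comparison[OF _ LIMSEQ_inverse_real_of_nat])
        (intro always_eventually allI less_imp_le f2)
    then have "(\<lambda>n. \<Sum>b\<in>B. f (r n) b *\<^sub>R b) \<longlonglongrightarrow> 0"
      using LIMSEQ_subseq_LIMSEQ[OF _ r] by (force simp: o_def)
    moreover have "(\<lambda>n. \<Sum>b\<in>B. f (r n) b *\<^sub>R b) \<longlonglongrightarrow> (\<Sum>b\<in>B. l b *\<^sub>R b)"
      by (intro tendsto_intros lim)
    ultimately have "(\<Sum>b\<in>B. l b *\<^sub>R b) = 0"
      using LIMSEQ_unique by blast
    then have "\<forall>b\<in>B. l b = 0"
      using real_vector.independentD[OF assms(2,1)] by blast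
    \<comment> \<open>The limit coefficients vanish, although the sums of absolute values are
      constantly 1 along the sequence.\<close>
    then have "(\<lambda>n. \<Sum>b\<in>B. \<bar>f (r n) b\<bar>) \<longlonglongrightarrow> (\<Sum>b\<in>B. \<bar>0\<bar>)"
      by (intro tendsto_intros) (use lim in force)
    then show False
      by (simp add: f1 LIMSEQ_const_iff)
  qed
  then obtain \<delta> where \<delta>: "\<delta> > 0"
    and bd: "\<And>a. (\<Sum>b\<in>B. \<bar>a b\<bar>) = 1 \<Longrightarrow> \<delta> \<le> norm (\<Sum>b\<in>B. a b *\<^sub>R b)"
    by blast
  have "(\<Sum>b\<in>B. \<bar>a b\<bar>) \<le> inverse \<delta> * norm (\<Sum>b\<in>B. a b *\<^sub>R b)" for a
  proof (cases "(\<Sum>b\<in>B. \<bar>a b\<bar>) = 0")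
    case False
    define s where "s = (\<Sum>b\<in>B. \<bar>a b\<bar>)"
    have s: "s > 0"
      using False by (simp add: s_def order_less_le sum_nonneg)
    have "\<delta> \<le> norm (\<Sum>b\<in>B. (a b / s) *\<^sub>R b)"
      by (rule bd) (use s in \<open>simp add: sum_divide_distrib[symmetric] abs_divide flip: s_def\<close>)
    also have "(\<Sum>b\<in>B. (a b / s) *\<^sub>R b) = inverse s *\<^sub>R (\<Sum>b\<in>B. a b *\<^sub>R b)"
      by (simp add: scaleR_sum_right divide_inverse mult.commute)
    finally show ?thesis
      using s \<delta> by (simp add: field_simps flip: s_def)
  qed (use \<delta> in simp)
  then show ?thesis
    using that by blast
qed

text \<open>A single coordinate is dominated by the l1 norm of all of them, and
  \<open>independent_coeff_bound\<close> controls that by the norm of the vector.\<close>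

lemma bounded_linear_representation:
  fixes B :: "'e::real_normed_vector set"
  assumes "finite B" "independent B" "span B = UNIV"
  shows "bounded_linear (\<lambda>u. representation B u b)"
proof -
  obtain C where C: "\<And>a. (\<Sum>b\<in>B. \<bar>a b\<bar>) \<le> C * norm (\<Sum>b\<in>B. a b *\<^sub>R b)"
    using independent_coeff_bound assms by metis
  show ?thesis
  \<comment> \<open>For empty \<open>B\<close> the estimate does not determine the sign of
    \<open>C\<close>; hence the absolute value.\<close>
  proof (rule bounded_linear_intro[where K = "\<bar>C\<bar>"])
    fix u
    show "norm (representation B u b) \<le> norm u * \<bar>C\<bar>"
    proof (cases "b \<in> B")
      case True
      have "\<bar>representation B u b\<bar> \<le> (\<Sum>b\<in>B. \<bar>representation B u b\<bar>)"
        using True assms(1) by (intro member_le_sum) auto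
      also have "\<dots> \<le> C * norm (\<Sum>b\<in>B. representation B u b *\<^sub>R b)"
        by (rule C)
      also have "(\<Sum>b\<in>B. representation B u b *\<^sub>R b) = u"
        using assms by (intro real_vector.sum_representation_eq) auto
      also have "C * norm u \<le> norm u * \<bar>C\<bar>"
        by (subst mult.commute) (simp add: mult_left_mono)
      finally show ?thesis by simp
    next
      case False
      then have "representation B u b = 0"
        using real_vector.representation_ne_zero by blast
      then show ?thesis by simp
    qed
  qed (use assms in \<open>simp_all add: real_vector.representation_add real_vector.representation_scale\<close>)
qed

text \<open>Expanding \<open>u\<close> in a basis writes \<open>A x u\<close> as a finite sum of
  products, each of a continuous coordinate of \<open>u\<close> and a continuous function of
  \<open>x\<close>. It will be applied to the derivative of a transition map.\<close>

lemma continuous_on_linear_family: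
  fixes A :: "'x::topological_space \<Rightarrow> 'e::real_normed_vector \<Rightarrow> 'f::real_normed_vector"
  assumes "finite B" "span B = (UNIV :: 'e set)"
    and lin: "\<And>x. x \<in> S \<Longrightarrow> linear (A x)"
    and cont: "\<And>v. continuous_on S (\<lambda>x. A x v)"
  shows "continuous_on (S \<times> UNIV) (\<lambda>(x, u). A x u)"
proof -
  \<comment> \<open>\<open>B\<close> merely spans; a basis is cut out of it so that coordinates
    exist.\<close>
  obtain B' where "B' \<subseteq> B" "independent B'" "B \<subseteq> span B'"
    using real_vector.maximal_independent_subset by blast
  then have B': "finite B'" "independent B'" "span B' = UNIV"
    using assms(1,2) by (auto intro: finite_subset)
      (metis UNIV_I real_vector.span_mono real_vector.span_span subsetD)
  have "A x u = (\<Sum>b\<in>B'. representation B' u b *\<^sub>R A x b)" if "x \<in> S" for x u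
  proof -
    have "A x u = A x (\<Sum>b\<in>B'. representation B' u b *\<^sub>R b)"
      using B' by (subst real_vector.sum_representation_eq) auto
    also have "\<dots> = (\<Sum>b\<in>B'. representation B' u b *\<^sub>R A x b)"
      using lin[OF that] by (simp add: linear_sum linear_scale)
    finally show ?thesis .
  qed
  then have "continuous_on (S \<times> UNIV) (\<lambda>(x, u). A x u) \<longleftrightarrow>
      continuous_on (S \<times> UNIV) (\<lambda>p. \<Sum>b\<in>B'. representation B' (snd p) b *\<^sub>R A (fst p) b)"
    by (intro continuous_on_cong) auto
  moreover have "continuous_on (S \<times> UNIV) (\<lambda>p. A (fst p) b)" for b
    by (rule continuous_on_compose2[OF cont continuous_on_fst[OF continuous_on_id]]) auto
  then have "continuous_on (S \<times> UNIV) (\<lambda>p. \<Sum>b\<in>B'. representation B' (snd p) b *\<^sub>R A (fst p) b)"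
    by (intro continuous_intros bounded_linear.continuous_on[OF bounded_linear_representation[OF B']])
  ultimately show ?thesis by blast
qed

subsection \<open>\<open>C\<^sup>k\<close> maps and linear changes of coordinates\<close>

text \<open>Both maps have the same derivatives at \<open>x\<close>, and
  \<open>frechet_derivative\<close> is a choice among these, so the values agree even where neither
  map is differentiable.\<close>

lemma frechet_derivative_cong_open:
  assumes "open T" "x \<in> T" "\<And>y. y \<in> T \<Longrightarrow> f y = g y"
  shows "frechet_derivative f (at x) = frechet_derivative g (at x)"
    and "f differentiable (at x) \<longleftrightarrow> g differentiable (at x)"
proof -
  have "(f has_derivative D) (at x) \<longleftrightarrow> (g has_derivative D) (at x)" for D
    using assms has_derivative_transform_within_open[of _ D x UNIV T] by metis
  then show "frechet_derivative f (at x) = frechet_derivative g (at x)"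
    and "f differentiable (at x) \<longleftrightarrow> g differentiable (at x)"
    by (simp_all add: frechet_derivative_def differentiable_def)
qed

text \<open>Agreement on an open \<open>T\<close> passes to the derivatives on all of
  \<open>T\<close>, so the induction can keep \<open>T\<close> fixed. Agreement on \<open>S\<close>
  alone would say nothing about derivatives at points of \<open>S\<close> that are not
  interior.\<close>

lemma Ck_on_cong:
  assumes "Ck_on k S f" "open T" "S \<subseteq> T" "\<And>x. x \<in> T \<Longrightarrow> f x = g x"
  shows "Ck_on k S g"
  using assms
proof (induction k arbitrary: f g)
  case 0
  have "continuous_on S f \<longleftrightarrow> continuous_on S g"
    using 0 by (intro continuous_on_cong) auto
  with 0 show ?case by simp
next
  case (Suc k)
  note D = frechet_derivative_cong_open[of T _ f g, OF \<open>open T\<close> _ Suc.prems(4)]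
  have "g differentiable (at x)" if "x \<in> S" for x
    using Suc.prems(1,3) that D(2)[of x] by auto
  moreover have "Ck_on k S (\<lambda>x. frechet_derivative g (at x) v)" for v
    by (rule Suc.IH[of "\<lambda>x. frechet_derivative f (at x) v"]) (use Suc.prems D(1) in auto)
  ultimately show ?case by simp
qed

lemma frechet_derivative_compose_linear:
  assumes "f differentiable (at (L x))" "bounded_linear P" "bounded_linear L"
  shows "(\<lambda>x. P (f (L x))) differentiable (at x)"
    and "frechet_derivative (\<lambda>x. P (f (L x))) (at x) v = P (frechet_derivative f (at (L x)) (L v))"
proof -
  have "(L has_derivative L) (at x)"
    using assms(3) by (simp add: bounded_linear_imp_has_derivative)
  moreover have "(f has_derivative frechet_derivative f (at (L x))) (at (L x))"
    using assms(1) frechet_derivative_works by blast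
  ultimately have "((\<lambda>x. f (L x)) has_derivative (\<lambda>v. frechet_derivative f (at (L x)) (L v))) (at x)"
    using diff_chain_at by (fastforce simp: o_def)
  then have *: "((\<lambda>x. P (f (L x))) has_derivative
      (\<lambda>v. P (frechet_derivative f (at (L x)) (L v)))) (at x)"
    by (rule bounded_linear.has_derivative[OF assms(2)])
  then show "(\<lambda>x. P (f (L x))) differentiable (at x)"
    by (auto simp: differentiable_def)
  show "frechet_derivative (\<lambda>x. P (f (L x))) (at x) v = P (frechet_derivative f (at (L x)) (L v))"
    using frechet_derivative_at[OF *] by metis
qed

text \<open>Openness of \<open>S\<close> is essential: the iterated derivatives in \<^const>\<open>Ck_on\<close> see the values of
  \<^const>\<open>frechet_derivative\<close> near each point of \<open>S\<close>, and these are junk at points where the map is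
  not differentiable.\<close>

lemma Ck_on_compose_linear:
  assumes "Ck_on k S f" "open S" "bounded_linear P" "bounded_linear L"
  shows "Ck_on k (L -` S) (\<lambda>x. P (f (L x)))"
  using assms(1)
proof (induction k arbitrary: f)
  case 0
  then have "continuous_on (L -` S) (\<lambda>x. f (L x))"
    using linear_continuous_on[OF assms(4)] by (auto intro: continuous_on_compose2)
  then show ?case
    by (simp add: bounded_linear.continuous_on[OF assms(3)])
next
  case (Suc k)
  note D = frechet_derivative_compose_linear[OF _ assms(3,4)]
  have "open (L -` S)"
    using assms(2,4) by (simp add: linear_continuous_at continuous_open_vimage)
  \<comment> \<open>The derivative in direction \<open>v\<close> is again of the form in the claim,
    with \<open>f\<close> replaced by its derivative in the fixed direction \<open>L v\<close>. The
    two sides are known to agree on the preimage of \<open>S\<close>, where the chain rule applies,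
    and this set is open.\<close>
  then have "Ck_on k (L -` S) (\<lambda>x. frechet_derivative (\<lambda>x. P (f (L x))) (at x) v)" for v
    using Suc.prems
    by (intro Ck_on_cong[OF Suc.IH[of "\<lambda>x. frechet_derivative f (at x) (L v)"]])
       (auto simp: D(2))
  then show ?case
    using Suc.prems by (auto intro: D(1))
qed

subsection \<open>Charts of the tangent bundle\<close>

locale smooth_mfd =
  fixes M :: "('a, 'e::real_normed_vector) mfd"
  assumes smooth: "smooth_manifold M"
begin

abbreviation transition_deriv :: "('a, 'e) chart \<Rightarrow> ('a, 'e) chart \<Rightarrow> 'a \<Rightarrow> 'e \<Rightarrow> 'e"
  where "transition_deriv c d p \<equiv> frechet_derivative (snd d \<circ> chart_inv c) (at (snd c p))"

lemma charts_atD: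
  assumes "c \<in> charts_at M p"
  shows "c \<in> atlas M" "p \<in> fst c"
  using assms by (simp_all add: charts_at_def)

lemma charts_at_nonempty:
  assumes "p \<in> points M"
  obtains c where "c \<in> charts_at M p"
proof -
  have "\<Union> (fst ` atlas M) = points M"
    using smooth by (simp add: smooth_manifold_def)
  then have "p \<in> \<Union> (fst ` atlas M)"
    using assms by simp
  then show ?thesis
    using that by (auto simp: charts_at_def)
qed

lemma chart_domain_subset: "c \<in> atlas M \<Longrightarrow> fst c \<subseteq> points M"
  using smooth by (auto simp: smooth_manifold_def)

lemma homeomorphic_chart:
  "c \<in> atlas M \<Longrightarrow> homeomorphic_map (subtopology (mtop M) (fst c)) (top_of_set (snd c ` fst c)) (snd c)"
  using smooth by (simp add: smooth_manifold_def)

lemma inj_on_chart: "c \<in> atlas M \<Longrightarrow> inj_on (snd c) (fst c)"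
  using homeomorphic_imp_injective_map[OF homeomorphic_chart] chart_domain_subset
  by (simp add: Int_absorb1)

lemma chart_inv_left: "c \<in> atlas M \<Longrightarrow> p \<in> fst c \<Longrightarrow> chart_inv c (snd c p) = p"
  by (simp add: chart_inv_def inj_on_chart)

lemma open_overlap:
  assumes "c \<in> atlas M" "d \<in> atlas M"
  shows "open (snd c ` (fst c \<inter> fst d))"
proof -
  have "openin (subtopology (mtop M) (fst c)) (fst c \<inter> fst d)"
    using smooth assms by (simp add: smooth_manifold_def openin_subtopology_Int2)
  then have "openin (top_of_set (snd c ` fst c)) (snd c ` (fst c \<inter> fst d))"
    using homeomorphic_imp_open_map[OF homeomorphic_chart[OF assms(1)]]
    by (simp add: open_map_def)
  moreover have "open (snd c ` fst c)"
    using smooth assms by (simp add: smooth_manifold_def)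
  ultimately show ?thesis
    using openin_open_trans by blast
qed

lemma open_chart_image: "c \<in> atlas M \<Longrightarrow> open (snd c ` fst c)"
  using open_overlap[of c c] by simp

lemma smooth_transition:
  assumes "c \<in> atlas M" "d \<in> atlas M"
  shows "smooth_on (snd c ` (fst c \<inter> fst d)) (snd d \<circ> chart_inv c)"
  using smooth assms by (simp add: smooth_manifold_def)

lemma transition_differentiable:
  assumes "c \<in> charts_at M p" "d \<in> charts_at M p"
  shows "(snd d \<circ> chart_inv c) differentiable (at (snd c p))"
proof -
  have "Ck_on (Suc 0) (snd c ` (fst c \<inter> fst d)) (snd d \<circ> chart_inv c)"
    using smooth_transition assms[THEN charts_atD(1)] unfolding smooth_on_def by blast
  then show ?thesis
    using assms[THEN charts_atD(2)] by simp
qed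

lemma linear_transition_deriv:
  assumes "c \<in> charts_at M p" "d \<in> charts_at M p"
  shows "linear (transition_deriv c d p)"
  using transition_differentiable[OF assms] by (rule linear_frechet_derivative)

lemma transition_deriv_self:
  assumes "c \<in> charts_at M p"
  shows "transition_deriv c c p u = u"
proof -
  have "frechet_derivative (snd c \<circ> chart_inv c) (at (snd c p))
      = frechet_derivative (\<lambda>y. y) (at (snd c p))"
    by (rule frechet_derivative_cong_open[of "snd c ` fst c"])
      (use assms[THEN charts_atD(1)] assms[THEN charts_atD(2)] in
        \<open>auto simp: open_chart_image chart_inv_left\<close>)
  then show ?thesis by simp
qed

text \<open>The chain rule for the factorization of the transition from \<open>c\<close> to
  \<open>e\<close> through \<open>d\<close>. It is applied on the image under \<open>c\<close> of
  the overlap with \<open>d\<close>, an open neighbourhood of \<open>snd c p\<close>.\<close>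

lemma transition_deriv_cocycle:
  assumes "c \<in> charts_at M p" "d \<in> charts_at M p" "e \<in> charts_at M p"
  shows "transition_deriv d e p (transition_deriv c d p u) = transition_deriv c e p u"
proof -
  note atl = assms[THEN charts_atD(1)] and dom = assms[THEN charts_atD(2)]
  have "frechet_derivative (snd e \<circ> chart_inv c) (at (snd c p))
      = frechet_derivative ((snd e \<circ> chart_inv d) \<circ> (snd d \<circ> chart_inv c)) (at (snd c p))"
    by (rule frechet_derivative_cong_open[of "snd c ` (fst c \<inter> fst d)"])
      (use atl dom in \<open>auto simp: open_overlap chart_inv_left\<close>)
  also have "\<dots> = transition_deriv d e p \<circ> transition_deriv c d p"
    using frechet_derivative_compose[of "snd d \<circ> chart_inv c" "snd c p" "snd e \<circ> chart_inv d"]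
      transition_differentiable assms atl dom
    by (simp add: chart_inv_left)
  finally show ?thesis by simp
qed

text \<open>Inverse of the coordinate map of \<open>c\<close> on the fibre over \<open>p\<close>:
  the coordinate \<open>u\<close> in \<open>c\<close> forces all the others. It makes the
  \<open>inv_into\<close> hidden in the charts of fibre and bundle explicit.\<close>

definition tvec_of :: "('a, 'e) chart \<Rightarrow> 'a \<Rightarrow> 'e \<Rightarrow> ('a, 'e) tvec"
  where "tvec_of c p u = (\<lambda>d. if d \<in> charts_at M p then transition_deriv c d p u else 0)"

lemma tvec_of_in_tangent_space:
  assumes "c \<in> charts_at M p"
  shows "tvec_of c p u \<in> tangent_space M p"
  using assms by (auto simp: tangent_space_def tvec_of_def transition_deriv_cocycle)

lemma tvec_of_coord: "c \<in> charts_at M p \<Longrightarrow> tvec_of c p u c = u"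
  by (simp add: tvec_of_def transition_deriv_self)

lemma tvec_of_eq:
  assumes "v \<in> tangent_space M p" "c \<in> charts_at M p"
  shows "tvec_of c p (v c) = v"
proof
  fix d
  show "tvec_of c p (v c) d = v d"
  proof (cases "d \<in> charts_at M p")
    case True
    then have "v d = transition_deriv c d p (v c)"
      using assms unfolding tangent_space_def by blast
    with True show ?thesis by (simp add: tvec_of_def)
  next
    case False
    then have "v d = 0"
      using assms(1) unfolding tangent_space_def by blast
    with False show ?thesis by (simp add: tvec_of_def)
  qed
qed

lemma tvec_of_uminus: "c \<in> charts_at M p \<Longrightarrow> tvec_of c p (- u) = - tvec_of c p u"
  by (rule ext) (simp add: tvec_of_def linear_neg[OF linear_transition_deriv])

lemma tvec_of_zero: "c \<in> charts_at M p \<Longrightarrow> tvec_of c p 0 = 0"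
  by (rule ext) (simp add: tvec_of_def linear_0[OF linear_transition_deriv])

lemma zero_in_tangent_space:
  assumes "p \<in> points M"
  shows "0 \<in> tangent_space M p"
  by (metis assms charts_at_nonempty tvec_of_in_tangent_space tvec_of_zero)

lemma uminus_in_tangent_space:
  assumes "p \<in> points M" "v \<in> tangent_space M p"
  shows "- v \<in> tangent_space M p"
  by (metis assms charts_at_nonempty tvec_of_in_tangent_space tvec_of_eq tvec_of_uminus)

lemma inj_on_coord:
  assumes "c \<in> charts_at M p"
  shows "inj_on (\<lambda>v. v c) (tangent_space M p)"
  by (rule inj_onI) (metis assms tvec_of_eq)

lemma chart_inv_tangent_space:
  assumes "c \<in> charts_at M p"
  shows "chart_inv (tangent_space M p, \<lambda>v. v c) u = tvec_of c p u"
  using inv_into_f_f[OF inj_on_coord[OF assms] tvec_of_in_tangent_space[OF assms, of u]] assms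
  by (simp add: chart_inv_def tvec_of_coord)

lemma chart_inv_TM_chart:
  assumes "c \<in> charts_at M p"
  shows "chart_inv (TM_chart M c) (snd c p, u) = (p, tvec_of c p u)"
proof -
  have "inj_on (snd (TM_chart M c)) (fst (TM_chart M c))"
  proof (clarsimp simp: inj_on_def TM_chart_def)
    fix x v y w
    assume x: "x \<in> fst c" and v: "v \<in> tangent_space M x" and y: "y \<in> fst c"
      and w: "w \<in> tangent_space M y" and eq: "snd c x = snd c y" "v c = w c"
    have "x = y"
      using charts_atD(1)[OF assms] chart_inv_left x y eq(1) by metis
    moreover have "c \<in> charts_at M x"
      using charts_atD(1)[OF assms] x by (simp add: charts_at_def)
    ultimately show "x = y \<and> v = w"
      using v w eq(2) tvec_of_eq by metis
  qed
  moreover have "(p, tvec_of c p u) \<in> fst (TM_chart M c)"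
    using assms charts_atD(2)[OF assms] by (simp add: TM_chart_def tvec_of_in_tangent_space)
  moreover have "snd (TM_chart M c) (p, tvec_of c p u) = (snd c p, u)"
    using assms by (simp add: TM_chart_def tvec_of_coord)
  ultimately show ?thesis
    unfolding chart_inv_def by (metis inv_into_f_f)
qed

text \<open>A bundle chart is onto the whole model space in the fibre direction, so \<open>u\<close>
  is restricted only through \<open>W\<close>. This trades images of sets for preimages under
  \<open>chart_inv\<close>.\<close>

lemma TM_chart_image_Int:
  assumes "c \<in> atlas M"
  shows "(y, u) \<in> snd (TM_chart M c) ` (fst (TM_chart M c) \<inter> W) \<longleftrightarrow>
    y \<in> snd c ` fst c \<and> chart_inv (TM_chart M c) (y, u) \<in> W" (is "?l \<longleftrightarrow> ?r")
proof
  assume ?l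
  then obtain p v where p: "p \<in> fst c" "v \<in> tangent_space M p" "(p, v) \<in> W"
    and eq: "y = snd c p" "u = v c"
    by (auto simp: TM_chart_def)
  have "c \<in> charts_at M p"
    using assms p(1) by (simp add: charts_at_def)
  then show ?r
    using p by (simp add: eq chart_inv_TM_chart tvec_of_eq)
next
  assume ?r
  then obtain p where p: "p \<in> fst c" "y = snd c p" by blast
  have c: "c \<in> charts_at M p"
    using assms p(1) by (simp add: charts_at_def)
  have "(p, tvec_of c p u) \<in> fst (TM_chart M c) \<inter> W"
    using \<open>?r\<close> p tvec_of_in_tangent_space[OF c, of u]
    unfolding p(2) chart_inv_TM_chart[OF c] by (simp add: TM_chart_def)
  moreover have "(y, u) = snd (TM_chart M c) (p, tvec_of c p u)"
    using p by (simp add: TM_chart_def tvec_of_coord[OF c])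
  ultimately show ?l by blast
qed

text \<open>Transition maps of the tangent bundle are jointly continuous in point and vector, so its
  charts are open maps although its topology is only given by a subbasis.\<close>

lemma open_TM_basis_image:
  assumes "c \<in> atlas M" "d \<in> atlas M" "open V"
  shows "open (snd (TM_chart M c) `
    (fst (TM_chart M c) \<inter> {z \<in> fst (TM_chart M d). snd (TM_chart M d) z \<in> V}))"
proof -
  define S where "S = snd c ` (fst c \<inter> fst d)"
  define \<tau> where "\<tau> = snd d \<circ> chart_inv c"
  \<comment> \<open>\<open>G\<close> is the bundle transition map from \<open>c\<close> to
    \<open>d\<close> in coordinates; the image in question will be the preimage of \<open>V\<close>
    under it, over the overlap.\<close>
  define G where "G = (\<lambda>(y, u). (\<tau> y, frechet_derivative \<tau> (at y) u))"
  have Ck: "Ck_on k S \<tau>" for k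
    using smooth_transition[OF assms(1,2)] by (simp add: S_def \<tau>_def smooth_on_def)
  obtain B :: "'e set" where B: "finite B" "span B = UNIV"
    using smooth by (auto simp: smooth_manifold_def)
  \<comment> \<open>\<open>Ck_on\<close> at level 1 gives continuity in \<open>y\<close> for each
    fixed \<open>u\<close>; linearity in \<open>u\<close> makes it joint.\<close>
  have "continuous_on (S \<times> UNIV) (\<lambda>(y, u). frechet_derivative \<tau> (at y) u)"
    using B Ck[of "Suc 0"]
    by (intro continuous_on_linear_family) (auto intro: linear_frechet_derivative)
  moreover have "continuous_on (S \<times> UNIV) (\<lambda>q. \<tau> (fst q))"
    using Ck[of 0]
    by (intro continuous_on_compose2[OF _ continuous_on_fst[OF continuous_on_id], of S \<tau>]) auto
  ultimately have "continuous_on (S \<times> UNIV) G"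
    unfolding G_def split_def by (intro continuous_on_Pair)
  moreover have "open (S \<times> (UNIV :: 'e set))"
    using open_overlap[OF assms(1,2)] by (simp add: S_def open_Times)
  ultimately have "open ((S \<times> UNIV) \<inter> G -` V)"
    using assms(3) continuous_on_open_vimage[of "S \<times> UNIV" G] by (simp add: Int_commute)
  moreover have "snd (TM_chart M c) `
      (fst (TM_chart M c) \<inter> {z \<in> fst (TM_chart M d). snd (TM_chart M d) z \<in> V})
      = (S \<times> UNIV) \<inter> G -` V" (is "?I = _")
  proof (rule set_eqI)
    fix q :: "'e \<times> 'e"
    obtain y u where q: "q = (y, u)" by fastforce
    show "q \<in> ?I \<longleftrightarrow> q \<in> (S \<times> UNIV) \<inter> G -` V"
    proof (cases "y \<in> snd c ` fst c")
      case True
      then obtain p where p: "p \<in> fst c" "y = snd c p" by blast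
      have c: "c \<in> charts_at M p"
        using assms(1) p by (simp add: charts_at_def)
      have "y \<in> S \<longleftrightarrow> p \<in> fst d"
        using inj_on_image_mem_iff[OF inj_on_chart[OF assms(1)] p(1), of "fst c \<inter> fst d"] p
        by (simp add: S_def)
      moreover have "p \<in> fst d \<Longrightarrow> d \<in> charts_at M p"
        using assms(2) by (simp add: charts_at_def)
      ultimately show ?thesis
        unfolding q TM_chart_image_Int[OF assms(1)] p(2) chart_inv_TM_chart[OF c]
        using p(1) assms(1) tvec_of_in_tangent_space[OF c, of u]
        by (simp add: G_def \<tau>_def TM_chart_def chart_inv_left)
          (simp add: tvec_of_def conj_commute cong: conj_cong)
    next
      case False
      then show ?thesis
        unfolding q TM_chart_image_Int[OF assms(1)] by (auto simp: S_def)
    qed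
  qed
  ultimately show ?thesis by simp
qed

lemma open_TM_chart_image:
  assumes "c \<in> atlas M" "openin (mtop (tangent_bundle M)) W"
  shows "open (snd (TM_chart M c) ` (fst (TM_chart M c) \<inter> W))" (is "open (?I W)")
proof -
  \<comment> \<open>Written as a preimage, the image commutes with intersections, as the
    \<open>Int\<close> case of the induction requires.\<close>
  have *: "?I W = (snd c ` fst c \<times> UNIV) \<inter> chart_inv (TM_chart M c) -` W" for W
    using TM_chart_image_Int[OF assms(1), of _ _ W] by (intro set_eqI) (simp only: split_paired_all, simp)
  have "generate_topology_on {{z \<in> fst (TM_chart M d). snd (TM_chart M d) z \<in> V} | d V.
      d \<in> atlas M \<and> open V} W"
    using assms(2) by (simp add: tangent_bundle_def openin_topology_generated_by_iff)
  then show ?thesis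
  proof induction
    case Empty
    then show ?case by simp
  next
    case (Int a b)
    have "?I (a \<inter> b) = ?I a \<inter> ?I b"
      unfolding * by auto
    with Int.IH show ?case by auto
  next
    case (UN K)
    have "?I (\<Union>K) = (\<Union>k\<in>K. ?I k)" by auto
    with UN.IH show ?case by auto
  next
    case (Basis s)
    with assms(1) show ?case by (auto intro: open_TM_basis_image)
  qed
qed

lemma TM_chart_domain_openin:
  assumes "c \<in> atlas M"
  shows "openin (mtop (tangent_bundle M)) (fst (TM_chart M c))"
proof -
  have "{z \<in> fst (TM_chart M c). snd (TM_chart M c) z \<in> UNIV} \<in>
      {{z \<in> fst (TM_chart M c). snd (TM_chart M c) z \<in> V} | c V. c \<in> atlas M \<and> open V}"
    by (rule CollectI, intro exI[of _ c] exI[of _ UNIV]) (simp add: assms)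
  from topology_generated_by_Basis[OF this] show ?thesis
    by (simp add: tangent_bundle_def)
qed

lemma topspace_tangent_bundle: "topspace (mtop (tangent_bundle M)) = TM_points M"
proof (intro subset_antisym subsetI)
  fix z
  assume "z \<in> topspace (mtop (tangent_bundle M))"
  then obtain c where "c \<in> atlas M" "z \<in> fst (TM_chart M c)"
    unfolding tangent_bundle_def mfd.select_convs topology_generated_by_topspace by blast
  then show "z \<in> TM_points M"
    using chart_domain_subset[of c] by (auto simp: TM_points_def TM_chart_def)
next
  fix z
  assume "z \<in> TM_points M"
  then obtain p v where z: "z = (p, v)" "p \<in> points M" "v \<in> tangent_space M p"
    by (auto simp: TM_points_def)
  then obtain c where c: "c \<in> charts_at M p"
    using charts_at_nonempty by blast
  then have "z \<in> fst (TM_chart M c)"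
    using z charts_atD(2)[OF c] by (simp add: TM_chart_def)
  then show "z \<in> topspace (mtop (tangent_bundle M))"
    using TM_chart_domain_openin[OF charts_atD(1)[OF c]] openin_subset by blast
qed

subsection \<open>Fibrewise reflection of the tangent bundle\<close>

lemma uminus_in_TM_points: "z \<in> TM_points M \<Longrightarrow> map_prod id uminus z \<in> TM_points M"
  by (auto simp: TM_points_def uminus_in_tangent_space)

lemma TM_chart_domain_subset: "c \<in> atlas M \<Longrightarrow> fst (TM_chart M c) \<subseteq> TM_points M"
  using TM_chart_domain_openin openin_subset topspace_tangent_bundle by metis

lemma TM_chart_uminus:
  assumes "c \<in> atlas M" "z \<in> TM_points M"
  shows "map_prod id uminus z \<in> fst (TM_chart M c) \<longleftrightarrow> z \<in> fst (TM_chart M c)"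
    and "snd (TM_chart M c) (map_prod id uminus z) = map_prod id uminus (snd (TM_chart M c) z)"
  using assms(2) uminus_in_TM_points[OF assms(2)]
  by (auto simp: TM_chart_def TM_points_def)

lemma chart_inv_TM_chart_uminus:
  assumes "c \<in> atlas M" "y \<in> snd c ` fst c"
  shows "chart_inv (TM_chart M c) (y, - u) = map_prod id uminus (chart_inv (TM_chart M c) (y, u))"
proof -
  obtain p where "p \<in> fst c" "y = snd c p"
    using assms(2) by blast
  moreover from this have "c \<in> charts_at M p"
    using assms(1) by (simp add: charts_at_def)
  ultimately show ?thesis
    by (simp add: chart_inv_TM_chart tvec_of_uminus)
qed

text \<open>In every bundle chart the reflection reads \<open>(y, u)\<close> ->
  \<open>(y, - u)\<close>, so it pulls a subbasic set back to a subbasic set of the same chart, with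
  \<open>V\<close> reflected.\<close>

lemma continuous_map_TM_uminus:
  "continuous_map (mtop (tangent_bundle M)) (mtop (tangent_bundle M)) (map_prod id uminus)"
proof -
  define \<B> where "\<B> = {{z \<in> fst (TM_chart M c). snd (TM_chart M c) z \<in> V} | c V.
    c \<in> atlas M \<and> open V}"
  have TM: "mtop (tangent_bundle M) = topology_generated_by \<B>"
    by (simp add: tangent_bundle_def \<B>_def)
  have "openin (topology_generated_by \<B>) (map_prod id uminus -` W \<inter> TM_points M)" if "W \<in> \<B>" for W
  proof -
    obtain c V where c: "c \<in> atlas M" and V: "open V"
      and W: "W = {z \<in> fst (TM_chart M c). snd (TM_chart M c) z \<in> V}"
      using \<open>W \<in> \<B>\<close> unfolding \<B>_def by blast
    have "map_prod id uminus -` W \<inter> TM_points M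
        = {z \<in> fst (TM_chart M c). snd (TM_chart M c) z \<in> map_prod id uminus -` V}"
      unfolding W using TM_chart_uminus[OF c] TM_chart_domain_subset[OF c] by fastforce
    moreover have "open (map_prod id uminus -` V :: ('e \<times> 'e) set)"
      unfolding map_prod_def split_def
      using V by (intro continuous_open_vimage) (auto intro!: continuous_intros)
    ultimately have "map_prod id uminus -` W \<inter> TM_points M \<in> \<B>"
      using c unfolding \<B>_def by blast
    then show ?thesis
      by (rule topology_generated_by_Basis)
  qed
  moreover have "\<Union>\<B> = TM_points M"
    using topspace_tangent_bundle by (simp add: TM)
  ultimately show ?thesis
    unfolding TM
    by (intro continuous_on_generated_topo) (use uminus_in_TM_points in auto)
qed

section \<open>Domain and smoothness of the adjoint map\<close>

lemma adjoint_map_eq: "adjoint_map R = prod.swap \<circ> R \<circ> map_prod id uminus"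
  by (auto simp: adjoint_map_def inversion_map_def fun_eq_iff split: prod.split)

lemma adjoint_domain_eq:
  "adjoint_domain M U = {z \<in> topspace (mtop (tangent_bundle M)). map_prod id uminus z \<in> U}"
  by (auto simp: adjoint_domain_def topspace_tangent_bundle)

lemma openin_adjoint_domain:
  assumes "openin (mtop (tangent_bundle M)) U"
  shows "openin (mtop (tangent_bundle M)) (adjoint_domain M U)"
  unfolding adjoint_domain_eq
  by (rule openin_continuous_map_preimage[OF continuous_map_TM_uminus assms])

text \<open>In charts the adjoint is swap o \<open>f\<close> o \<open>L\<close>, where
  \<open>f\<close> represents the original map and \<open>L\<close> is the reflection of the model
  space; \<open>Ck_on_compose_linear\<close> then applies at every order.\<close>

lemma smooth_map_on_adjoint:
  assumes "smooth_map_on (tangent_bundle M) (prod_mfd M M) U R"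
  shows "smooth_map_on (tangent_bundle M) (prod_mfd M M) (adjoint_domain M U) (adjoint_map R)"
  unfolding smooth_map_on_def
proof (intro conjI ballI)
  have U: "openin (mtop (tangent_bundle M)) U"
    and R: "continuous_map (subtopology (mtop (tangent_bundle M)) U) (prod_topology (mtop M) (mtop M)) R"
    using assms by (simp_all add: smooth_map_on_def prod_mfd_def)
  show "openin (mtop (tangent_bundle M)) (adjoint_domain M U)"
    using U by (rule openin_adjoint_domain)
  have "continuous_map (subtopology (mtop (tangent_bundle M)) (adjoint_domain M U))
      (subtopology (mtop (tangent_bundle M)) U) (map_prod id uminus)"
    using continuous_map_TM_uminus
    by (auto simp: continuous_map_in_subtopology adjoint_domain_eq intro: continuous_map_from_subtopology)
  moreover have "continuous_map (prod_topology (mtop M) (mtop M)) (prod_topology (mtop M) (mtop M)) prod.swap"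
    unfolding prod.swap_def by (intro continuous_map_pairedI continuous_map_fst continuous_map_snd)
  ultimately show "continuous_map (subtopology (mtop (tangent_bundle M)) (adjoint_domain M U))
      (mtop (prod_mfd M M)) (adjoint_map R)"
    unfolding adjoint_map_eq prod_mfd_def mfd.select_convs
    using R by (intro continuous_map_compose)
next
  fix C D
  assume "C \<in> atlas (tangent_bundle M)" "D \<in> atlas (prod_mfd M M)"
  then obtain c d e where c: "c \<in> atlas M" and C: "C = TM_chart M c"
    and d: "d \<in> atlas M" and e: "e \<in> atlas M"
    and D: "D = (fst d \<times> fst e, map_prod (snd d) (snd e))"
    by (auto simp: tangent_bundle_def prod_mfd_def)
  \<comment> \<open>The adjoint takes values in the domain of \<open>D\<close> exactly where the map
    \<open>R\<close>, after the reflection, takes values in that of the transposed chart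
    \<open>D'\<close>.\<close>
  define D' where "D' = (fst e \<times> fst d, map_prod (snd e) (snd d))"
  define W where "W = {p \<in> U. R p \<in> fst D'}"
  define S where "S = snd C ` (fst C \<inter> W)"
  define f where "f = snd D' \<circ> R \<circ> chart_inv C"
  define L :: "'e \<times> 'e \<Rightarrow> 'e \<times> 'e" where "L = map_prod id uminus"
  have U: "openin (mtop (tangent_bundle M)) U"
    and R: "continuous_map (subtopology (mtop (tangent_bundle M)) U) (prod_topology (mtop M) (mtop M)) R"
    using assms by (simp_all add: smooth_map_on_def prod_mfd_def)
  have "openin (prod_topology (mtop M) (mtop M)) (fst D')"
    using smooth d e by (simp add: D'_def smooth_manifold_def openin_prod_Times_iff)
  from openin_continuous_map_preimage[OF R this]
  have "openin (mtop (tangent_bundle M)) W"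
    using U openin_subset[OF U] by (auto simp: W_def openin_open_subtopology Int_absorb1)
  \<comment> \<open>The openness of bundle charts is spent here: \<open>W\<close> is open by
    continuity of \<open>R\<close>, and \<open>Ck_on_compose_linear\<close> requires its coordinate
    image to be open.\<close>
  then have open_S: "open S"
    unfolding S_def C by (rule open_TM_chart_image[OF c])
  have "D' \<in> atlas (prod_mfd M M)" "C \<in> atlas (tangent_bundle M)"
    unfolding prod_mfd_def D'_def C tangent_bundle_def mfd.select_convs using c d e by blast+
  then have "smooth_on (snd C ` {p \<in> fst C \<inter> U. R p \<in> fst D'}) f"
    using assms by (simp add: smooth_map_on_def f_def)
  moreover have "{p \<in> fst C \<inter> U. R p \<in> fst D'} = fst C \<inter> W"
    by (auto simp: W_def)
  ultimately have smooth_f: "smooth_on S f"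
    by (simp add: S_def)
  have L: "bounded_linear L"
    unfolding L_def map_prod_def split_def id_def
    by (intro bounded_linear_Pair bounded_linear_fst bounded_linear_minus bounded_linear_snd)
  have swap: "bounded_linear (prod.swap :: 'e \<times> 'e \<Rightarrow> 'e \<times> 'e)"
    unfolding prod.swap_def by (intro bounded_linear_Pair bounded_linear_fst bounded_linear_snd)
  have image: "snd C ` {p \<in> fst C \<inter> adjoint_domain M U. adjoint_map R p \<in> fst D} = L -` S"
  proof -
    define W' where "W' = {p \<in> adjoint_domain M U. adjoint_map R p \<in> fst D}"
    have "q \<in> snd C ` (fst C \<inter> W') \<longleftrightarrow> q \<in> L -` S" for q
    proof -
      obtain y u where q: "q = (y, u)" by fastforce
      have "chart_inv C (y, u) \<in> W' \<longleftrightarrow> chart_inv C (y, - u) \<in> W" if y: "y \<in> snd c ` fst c"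
      proof -
        \<comment> \<open>\<open>adjoint_domain\<close> admits only genuine tangent vectors, so
          membership in \<open>TM_points\<close> is secured before the two conditions are
          compared.\<close>
        have "(y, u) \<in> snd C ` (fst C \<inter> UNIV)"
          using TM_chart_image_Int[OF c, of y u UNIV] y unfolding C by simp
        then have "chart_inv C (y, u) \<in> fst C"
          using TM_chart_image_Int[OF c, of y u "fst C"] unfolding C by simp
        then have "chart_inv C (y, u) \<in> TM_points M"
          using TM_chart_domain_subset[OF c] unfolding C by blast
        then show ?thesis
          unfolding C chart_inv_TM_chart_uminus[OF c y]
          by (auto simp: W_def W'_def adjoint_domain_eq topspace_tangent_bundle adjoint_map_eq
              D'_def D mem_Times_iff)
      qed
      then show ?thesis
        unfolding S_def L_def q vimage_eq map_prod_simp id_apply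
        unfolding C TM_chart_image_Int[OF c] by blast
    qed
    moreover have "{p \<in> fst C \<inter> adjoint_domain M U. adjoint_map R p \<in> fst D} = fst C \<inter> W'"
      by (auto simp: W'_def)
    ultimately show ?thesis by auto
  qed
  \<comment> \<open>Off the chart image \<open>chart_inv\<close> is unspecified. The equation is
    therefore stated on an open set containing the preimage of \<open>S\<close>, as
    \<open>Ck_on_cong\<close> requires.\<close>
  have eq: "prod.swap (f (L q)) = (snd D \<circ> adjoint_map R \<circ> chart_inv C) q"
    if q: "q \<in> snd c ` fst c \<times> UNIV" for q
  proof -
    obtain y u where "q = (y, u)" "y \<in> snd c ` fst c"
      using q by blast
    then show ?thesis
      using chart_inv_TM_chart_uminus[OF c, of y u]
      by (cases "R (map_prod id uminus (chart_inv (TM_chart M c) (y, u)))")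
        (simp add: f_def L_def C D D'_def adjoint_map_eq)
  qed
  show "smooth_on (snd C ` {p \<in> fst C \<inter> adjoint_domain M U. adjoint_map R p \<in> fst D})
      (snd D \<circ> adjoint_map R \<circ> chart_inv C)"
    unfolding image smooth_on_def
  proof
    fix k
    show "Ck_on k (L -` S) (snd D \<circ> adjoint_map R \<circ> chart_inv C)"
    proof (rule Ck_on_cong[of k _ "\<lambda>q. prod.swap (f (L q))" "snd c ` fst c \<times> UNIV"])
      show "Ck_on k (L -` S) (\<lambda>q. prod.swap (f (L q)))"
        using smooth_f open_S swap L by (intro Ck_on_compose_linear) (auto simp: smooth_on_def)
      show "open (snd c ` fst c \<times> (UNIV :: 'e set))"
        using open_chart_image[OF c] by (simp add: open_Times)
      show "L -` S \<subseteq> snd c ` fst c \<times> UNIV"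
        by (auto simp: L_def S_def C TM_chart_def)
    qed (rule eq)
  qed
qed

section \<open>Derivatives along a fibre at the zero vector\<close>

lemma charts_at_tangent_space_mfd:
  assumes "x \<in> points M"
  shows "charts_at (tangent_space_mfd M x) 0 = {(tangent_space M x, \<lambda>v. v c) | c. c \<in> charts_at M x}"
  using zero_in_tangent_space[OF assms] by (auto simp: charts_at_def tangent_space_mfd_def)

text \<open>The chain rule with the reflection, which is its own derivative and fixes 0, so both
  tangent maps end at the same point. Differentiability of \<open>g\<close> in charts is assumed
  because \<open>frechet_derivative\<close> is otherwise arbitrary and need not be odd.\<close>

lemma tangent_map_comp_uminus:
  assumes x: "x \<in> points M"
    and diff: "\<And>c d. c \<in> charts_at M x \<Longrightarrow> d \<in> charts_at M (g 0) \<Longrightarrow>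
      (snd d \<circ> g \<circ> tvec_of c x) differentiable (at 0)"
  shows "tangent_map (tangent_space_mfd M x) M (\<lambda>v. g (- v)) 0 w
    = - tangent_map (tangent_space_mfd M x) M g 0 w"
proof
  fix d
  \<comment> \<open>The chart chosen inside \<open>tangent_map\<close> depends on the manifold and
    the point but not on the map, so both sides are computed in this \<open>l\<close>.\<close>
  define l where "l = (SOME l. l \<in> charts_at (tangent_space_mfd M x) 0)"
  obtain c0 where "c0 \<in> charts_at M x"
    using charts_at_nonempty[OF x] by blast
  then have "(tangent_space M x, \<lambda>v. v c0) \<in> charts_at (tangent_space_mfd M x) 0"
    unfolding charts_at_tangent_space_mfd[OF x] by blast
  then have "l \<in> charts_at (tangent_space_mfd M x) 0"
    unfolding l_def by (rule someI)
  then obtain c where c: "c \<in> charts_at M x" and l: "l = (tangent_space M x, \<lambda>v. v c)"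
    unfolding charts_at_tangent_space_mfd[OF x] by blast
  have inv: "chart_inv l = tvec_of c x"
    using chart_inv_tangent_space[OF c] l by auto
  have l0: "snd l 0 = 0"
    by (simp add: l)
  show "tangent_map (tangent_space_mfd M x) M (\<lambda>v. g (- v)) 0 w d
    = (- tangent_map (tangent_space_mfd M x) M g 0 w) d"
  proof (cases "d \<in> charts_at M (g 0)")
    case True
    define h where "h = snd d \<circ> g \<circ> tvec_of c x"
    have h: "h differentiable (at 0)"
      unfolding h_def by (rule diff[OF c True])
    have "snd d \<circ> (\<lambda>v. g (- v)) \<circ> tvec_of c x = (\<lambda>u. h (- u))"
      by (auto simp: h_def tvec_of_uminus[OF c])
    moreover have "frechet_derivative (\<lambda>u. h (- u)) (at 0) (w l) = frechet_derivative h (at 0) (- w l)"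
      using frechet_derivative_compose_linear(2)[of h uminus 0 "\<lambda>y. y" "w l"] h
      by (simp add: bounded_linear_minus bounded_linear_ident)
    moreover have "frechet_derivative h (at 0) (- w l) = - frechet_derivative h (at 0) (w l)"
      by (rule linear_neg[OF linear_frechet_derivative[OF h]])
    ultimately show ?thesis
      using True by (simp add: tangent_map_def Let_def l0 inv h_def flip: l_def)
  next
    case False
    then show ?thesis
      by (simp add: tangent_map_def Let_def)
  qed
qed

text \<open>The chart representative of \<open>R\<close> is differentiable on the bundle; composing
  it with the affine inclusion of the fibre \<open>u\<close> -> \<open>(snd c x, u)\<close> and
  projecting to a factor yields both claims.\<close>

lemma fibre_restriction_differentiable:
  assumes R: "smooth_map_on (tangent_bundle M) (prod_mfd M M) U R"
    and x: "(x, 0) \<in> U" "R (x, 0) = (x, x)"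
    and c: "c \<in> charts_at M x" and d: "d \<in> charts_at M x"
  shows "(snd d \<circ> (\<lambda>v. fst (R (x, v))) \<circ> tvec_of c x) differentiable (at 0)"
    and "(snd d \<circ> (\<lambda>v. snd (R (x, v))) \<circ> tvec_of c x) differentiable (at 0)"
proof -
  define C where "C = TM_chart M c"
  define D where "D = (fst d \<times> fst d, map_prod (snd d) (snd d))"
  define f where "f = snd D \<circ> R \<circ> chart_inv C"
  have "C \<in> atlas (tangent_bundle M)" "D \<in> atlas (prod_mfd M M)"
    unfolding C_def D_def tangent_bundle_def prod_mfd_def mfd.select_convs
    using charts_atD(1)[OF c] charts_atD(1)[OF d] by blast+
  then have "smooth_on (snd C ` {p \<in> fst C \<inter> U. R p \<in> fst D}) f"
    using R by (simp add: smooth_map_on_def f_def)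
  then have "Ck_on (Suc 0) (snd C ` {p \<in> fst C \<inter> U. R p \<in> fst D}) f"
    unfolding smooth_on_def by blast
  then have diff: "\<forall>q\<in>snd C ` {p \<in> fst C \<inter> U. R p \<in> fst D}. f differentiable (at q)"
    unfolding Ck_on.simps by blast
  \<comment> \<open>Since \<open>R\<close> sends the zero vector to the diagonal point
    \<open>(x, x)\<close>, the same chart \<open>d\<close> can be used in both factors.\<close>
  have "(x, 0) \<in> {p \<in> fst C \<inter> U. R p \<in> fst D}"
    using x charts_atD(2)[OF c] charts_atD(2)[OF d] tvec_of_in_tangent_space[OF c, of 0]
    by (auto simp: C_def D_def TM_chart_def tvec_of_zero[OF c])
  from bspec[OF diff imageI[OF this]] have "f differentiable (at (snd c x, 0))"
    by (simp add: C_def TM_chart_def)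
  then obtain f' where "(f has_derivative f') (at (snd c x, 0))"
    by (auto simp: differentiable_def)
  moreover have "((\<lambda>u. (snd c x, u)) has_derivative (\<lambda>u. (0, u))) (at 0)"
    by (intro has_derivative_Pair has_derivative_const has_derivative_ident)
  ultimately have f: "((\<lambda>u. f (snd c x, u)) has_derivative (\<lambda>u. f' (0, u))) (at 0)"
    using diff_chain_at[of "\<lambda>u. (snd c x, u)" _ 0 f f'] by (simp add: o_def)
  have "snd d \<circ> (\<lambda>v. fst (R (x, v))) \<circ> tvec_of c x = (\<lambda>u. fst (f (snd c x, u)))"
    and "snd d \<circ> (\<lambda>v. snd (R (x, v))) \<circ> tvec_of c x = (\<lambda>u. snd (f (snd c x, u)))"
    by (auto simp: f_def C_def D_def chart_inv_TM_chart[OF c])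
  then show "(snd d \<circ> (\<lambda>v. fst (R (x, v))) \<circ> tvec_of c x) differentiable (at 0)"
    and "(snd d \<circ> (\<lambda>v. snd (R (x, v))) \<circ> tvec_of c x) differentiable (at 0)"
    using has_derivative_fst[OF f] has_derivative_snd[OF f] by (auto simp: differentiable_def)
qed

end

theorem proposition2p5:
  fixes M :: "('a, 'e::real_normed_vector) mfd"
    and U :: "('a \<times> ('a, 'e) tvec) set"
    and R :: "'a \<times> ('a, 'e) tvec \<Rightarrow> 'a \<times> 'a"
  assumes "smooth_manifold M"
    and "discretization_map M U R"
  shows "discretization_map M (adjoint_domain M U) (adjoint_map R)"
proof -
  interpret smooth_mfd M
    using assms(1) by unfold_locales
  have U: "openin (mtop (tangent_bundle M)) U" "\<And>x. x \<in> points M \<Longrightarrow> (x, 0) \<in> U"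
    and R: "smooth_map_on (tangent_bundle M) (prod_mfd M M) U R"
      "\<And>x. x \<in> points M \<Longrightarrow> R (x, 0) = (x, x)"
    and T: "\<And>x w. x \<in> points M \<Longrightarrow> w \<in> tangent_space M x \<Longrightarrow>
      tangent_map (tangent_space_mfd M x) M (\<lambda>v. snd (R (x, v))) 0 (vertical_lift M x w)
       - tangent_map (tangent_space_mfd M x) M (\<lambda>v. fst (R (x, v))) 0 (vertical_lift M x w) = w"
    using assms(2) unfolding discretization_map_def by blast+
  show ?thesis
    unfolding discretization_map_def
  proof (intro conjI ballI)
    show "openin (mtop (tangent_bundle M)) (adjoint_domain M U)"
      using U(1) by (rule openin_adjoint_domain)
    show "smooth_map_on (tangent_bundle M) (prod_mfd M M) (adjoint_domain M U) (adjoint_map R)"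
      using R(1) by (rule smooth_map_on_adjoint)
    fix x
    assume x: "x \<in> points M"
    show "(x, 0) \<in> adjoint_domain M U"
      using x U(2)[OF x] zero_in_tangent_space[OF x] by (simp add: adjoint_domain_def TM_points_def)
    show "adjoint_map R (x, 0) = (x, x)"
      using R(2)[OF x] by (simp add: adjoint_map_eq)
    fix w
    assume w: "w \<in> tangent_space M x"
    note diff = fibre_restriction_differentiable[OF R(1) U(2)[OF x] R(2)[OF x]]
    \<comment> \<open>\<open>R (x, 0) = (x, x)\<close> identifies the charts around the value at 0
      with charts around \<open>x\<close>, where \<open>diff\<close> supplies
      differentiability.\<close>
    have "tangent_map (tangent_space_mfd M x) M (\<lambda>v. fst (R (x, - v))) 0 (vertical_lift M x w)
        = - tangent_map (tangent_space_mfd M x) M (\<lambda>v. fst (R (x, v))) 0 (vertical_lift M x w)"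
      by (rule tangent_map_comp_uminus[OF x, of "\<lambda>v. fst (R (x, v))"]) (simp add: R(2)[OF x] diff)
    moreover have "tangent_map (tangent_space_mfd M x) M (\<lambda>v. snd (R (x, - v))) 0 (vertical_lift M x w)
        = - tangent_map (tangent_space_mfd M x) M (\<lambda>v. snd (R (x, v))) 0 (vertical_lift M x w)"
      by (rule tangent_map_comp_uminus[OF x, of "\<lambda>v. snd (R (x, v))"]) (simp add: R(2)[OF x] diff)
    ultimately show "tangent_map (tangent_space_mfd M x) M (\<lambda>v. snd (adjoint_map R (x, v))) 0
          (vertical_lift M x w)
        - tangent_map (tangent_space_mfd M x) M (\<lambda>v. fst (adjoint_map R (x, v))) 0
          (vertical_lift M x w) = w"
      using T[OF x w] by (simp add: adjoint_map_eq)
  qed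
qed

end
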